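(* Let $n\geq 2$, let $\vec{k}=(k_1,\ldots,k_m)$ with $1\leq k_i\leq n-1$, let $G\in F_n(\vec{k})$ be an $\mathfrak{sl}_n$ web, and let $S^{\star}\in\mathcal{S}tr(G)$ be a leading term stranding of $G$. Then every open strand of $S^{\star}$ is clockwise; that is, for all $1\leq i<j\leq n$, every open $(i,j)$-strand of $S^\star$ is clockwise.
   Context: **Webs.** Fix a horizontal line in $\mathbb{R}^2$ (the boundary axis). A half-plane graph is a finite graph embedded in the closed half-plane below the boundary axis, up to planar isotopy fixing the axis, meeting the axis in a finite set of vertices (boundary vertices; all other vertices are interior). For an oriented edge $e$ incident to a vertex $v$, put $\sigma_v(e)=1$ if $e$ is directed into $v$ and $-1$ if directed out of $v$. An $\mathfrak{sl}_n$ web is a directed half-plane graph $G$ with edge weights in $\{1,\ldots,n-1\}$, univalent boundary vertices, trivalent interior vertices, and $\sum_{i=1}^3\sigma_v(e_i)\ell_i\equiv 0 \pmod n$ at each interior vertex $v$ with incident edges $e_1,e_2,e_3$ of weights $\ell_1,\ell_2,\ell_3$. If $v_1,\ldots,v_m$ are the boundary vertices from left to right with boundary edges $e_i$ of weights $\ell_i$, the boundary weight vector is $\vec k=(k_1,\ldots,k_m)$ with $k_i=\ell_i$ if $\sigma_{v_i}(e_i)=1$ and $k_i=n-\ell_i$ if $\sigma_{v_i}(e_i)=-1$. $F_n(\vec k)$ is the set of $\mathfrak{sl}_n$ webs with boundary weight vector $\vec k$. **Curves.** An arc on $G$ is an oriented simple path in $G$ with both endpoints on the boundary axis; it is clockwise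 (resp. counterclockwise) if its terminal vertex is to the left (resp. right) of its initial vertex. A loop is an oriented simple closed path in $G$, clockwise or counterclockwise according to its orientation. A curve system on $G$ is a collection of arcs (open curves) and loops (closed curves). Orientations of curves need not agree with those of edges. **Strandings.** A stranding $S$ of $G$ is a curve system on $G$ whose curves (simple strands) are colored by $\{1,\ldots,n-1\}$ so that simple strands of the same color are pairwise disjoint. For an edge $e$, $S(e)=S^+(e)\sqcup S^-(e)$, where $S^+(e)$ (resp. $S^-(e)$) is the set of colors of simple strands directed with (resp. against) $e$; $\alpha_c^\vee(S(e))=1,-1,0$ according as $c\in S^+(e)$, $c\in S^-(e)$, $c\notin S(e)$. $S$ is valid if for each edge $e$ of weight $\ell$: (1) the nonzero $\alpha_c^\vee(S(e))$ alternate in sign as $c$ increases; (2) with $c_{\max}=\max S(e)$, $\sum_{c}\alpha_c^\vee(S(e))\,c$ equals $\ell$ if $c_{\max}\in S^+(e)$ and $\ell-n$ if $c_{\max}\in S^-(e)$. $\mathcal{S}tr(G)$ is the set of valid strandings. For $S\in\mathcal{S}tr(G)$, $b_S(e)=b_1\cdots b_n\in\{0,1\}^n$ is the binary vector with $b_c-b_{c+1}=\alpha_c^\vee(S(e))$ for $1\le c\le n-1$ and $b_n=0$ if $c_{\max}\in S^+(e)$, $b_n=1$ if $c_{\max}\in S^-(e)$; it has exactly $\ell$ ones. **$(i,j)$-strands.** For $1\le i<j\le n$, $L_{(i,j)}(S)$ is the curve system traversing each edge $e=u\mapsto v$ with $b_S(e)=b_1\cdots b_n$ from $u$ to $v$ if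 $b_i-b_j=1$, from $v$ to $u$ if $b_i-b_j=-1$, and not at all if $b_i=b_j$. These assemble into disjoint arcs and loops; each component is an $(i,j)$-strand of $S$. Simple strands of color $c$ are exactly the $(c,c+1)$-strands. **Web vector.** $V_k=\bigwedge_q^k\mathbb{C}_q^n$ is the $\mathbb{C}(q)$-vector space with basis the monomials $x_{\vec b}=x_{j_1}\wedge_q\cdots\wedge_q x_{j_k}$, $\vec b\in\{0,1\}^n$ with $|\vec b|=k$ ones, where $j_1<\cdots<j_k$ are the positions of the ones; $V_n(\vec k)=V_{k_1}\otimes\cdots\otimes V_{k_m}$ has basis of monomials $x_{\vec b_1}\otimes\cdots\otimes x_{\vec b_m}$ with $|\vec b_i|=k_i$. For $S\in\mathcal{S}tr(G)$ and boundary edge $e_j$, $\hat b_S(e_j)=b_S(e_j)$ if $\sigma_{v_j}(e_j)=1$ and $\vec 1-b_S(e_j)$ otherwise; $x_S=x_{\hat b_S(e_1)}\otimes\cdots\otimes x_{\hat b_S(e_m)}$. $\mathrm{cw}(S)$ is the number of closed clockwise $(i,j)$-strands and $\mathrm{ccw}(S)$ the number of counterclockwise $(i,j)$-strands (open or closed), over all $1\le i<j\le n$. The web vector is $f^\uparrow(G)=\sum_{S\in\mathcal{S}tr(G)}(-q)^{\mathrm{cw}(S)-\mathrm{ccw}(S)}x_S\in V_n(\vec k)$. **Leading term.** Let $\mathrm{seq}(\vec b)$ be the increasing sequence of positions of ones of $\vec b$. Monomials of $V_n(\vec k)$ are ordered by $\prec$, the lexicographic order on the concatenated sequences $\mathrm{seq}(\vec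 b_1)\cdots\mathrm{seq}(\vec b_m)$. The leading term $\mathrm{lt}(w)$ of nonzero $w$ is its $\prec$-smallest monomial with nonzero coefficient. A leading term stranding of $G$ is $S^\star\in\mathcal{S}tr(G)$ with $\mathrm{lt}(f^\uparrow(G))=x_{S^\star}$. *)

theory Defs
  imports
    "HOL-Complex_Analysis.Complex_Analysis"
    "HOL-Number_Theory.Cong"
    "HOL-Computational_Algebra.Polynomial"
    "HOL-Computational_Algebra.Fraction_Field"
    "HOL-Library.Poly_Mapping"
begin

section \<open>Webs\<close>

text \<open>
  The plane is \<^typ>\<open>complex\<close>, the boundary axis is the real axis, and the half-plane
  is \<open>Im z \<le> 0\<close>.  A web is given by an embedded representative of its isotopy class: every edge
  \<open>e\<close> carries a parametrised path \<open>curve G e\<close>, and is directed along it.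
  Multiple edges are allowed.
\<close>

record 'e web =
  verts :: "complex set"
  edges :: "'e set"
  curve :: "'e \<Rightarrow> real \<Rightarrow> complex"
  weight :: "'e \<Rightarrow> nat"

definition src :: "'e web \<Rightarrow> 'e \<Rightarrow> complex" where
  "src G e = pathstart (curve G e)"

definition tgt :: "'e web \<Rightarrow> 'e \<Rightarrow> complex" where
  "tgt G e = pathfinish (curve G e)"

text \<open>\<open>simple_path\<close> admits a path whose two ends coincide, so loop edges are not excluded here.\<close>

definition half_plane_graph :: "'e web \<Rightarrow> bool" where
  "half_plane_graph G \<longleftrightarrow>
     finite (verts G) \<and> finite (edges G) \<and>
     (\<forall>v\<in>verts G. Im v \<le> 0) \<and>
     (\<forall>e\<in>edges G.
        simple_path (curve G e) \<and>
        src G e \<in> verts G \<and> tgt G e \<in> verts G \<and>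
        (\<forall>z\<in>path_image (curve G e). Im z \<le> 0 \<and> (Im z = 0 \<longrightarrow> z \<in> verts G)) \<and>
        path_image (curve G e) \<inter> verts G \<subseteq> {src G e, tgt G e}) \<and>
     (\<forall>e\<in>edges G. \<forall>f\<in>edges G. e \<noteq> f \<longrightarrow>
        path_image (curve G e) \<inter> path_image (curve G f) \<subseteq> verts G)"

definition boundary_verts :: "'e web \<Rightarrow> complex set" where
  "boundary_verts G = {v \<in> verts G. Im v = 0}"

definition interior_verts :: "'e web \<Rightarrow> complex set" where
  "interior_verts G = {v \<in> verts G. Im v \<noteq> 0}"

definition in_edges :: "'e web \<Rightarrow> complex \<Rightarrow> 'e set" where
  "in_edges G v = {e \<in> edges G. tgt G e = v}"

definition out_edges :: "'e web \<Rightarrow> complex \<Rightarrow> 'e set" where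
  "out_edges G v = {e \<in> edges G. src G e = v}"

text \<open>A loop edge at \<open>v\<close> counts twice.\<close>

definition valence :: "'e web \<Rightarrow> complex \<Rightarrow> nat" where
  "valence G v = card (in_edges G v) + card (out_edges G v)"

definition sl_web :: "nat \<Rightarrow> 'e web \<Rightarrow> bool" where
  "sl_web n G \<longleftrightarrow>
     half_plane_graph G \<and>
     (\<forall>e\<in>edges G. weight G e \<in> {1..n-1}) \<and>
     (\<forall>v\<in>boundary_verts G. valence G v = 1) \<and>
     (\<forall>v\<in>interior_verts G. valence G v = 3 \<and>
        [(\<Sum>e\<in>in_edges G v. int (weight G e)) - (\<Sum>e\<in>out_edges G v. int (weight G e)) = 0]
          (mod int n))"

definition boundary_list :: "'e web \<Rightarrow> complex list" where
  "boundary_list G = map complex_of_real (sorted_list_of_set (Re ` boundary_verts G))"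

definition boundary_edge :: "'e web \<Rightarrow> complex \<Rightarrow> 'e" where
  "boundary_edge G v = (THE e. e \<in> in_edges G v \<union> out_edges G v)"

definition boundary_weights :: "nat \<Rightarrow> 'e web \<Rightarrow> nat list" where
  "boundary_weights n G =
     map (\<lambda>v. let e = boundary_edge G v
              in if tgt G e = v then weight G e else n - weight G e)
       (boundary_list G)"

definition webs :: "nat \<Rightarrow> nat list \<Rightarrow> 'e web set" where
  "webs n k = {G. sl_web n G \<and> boundary_weights n G = k}"


section \<open>Curves\<close>

text \<open>
  A directed edge \<open>(e, True)\<close> is \<open>e\<close> traversed along its own direction, \<open>(e, False)\<close> is \<open>e\<close>
  traversed backwards.  An arc or loop is represented by the set of its directed edges; this
  determines it, and for loops it removes the choice of a base point.
\<close>

type_synonym 'e dedge = "'e \<times> bool"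

fun dsrc :: "'e web \<Rightarrow> 'e dedge \<Rightarrow> complex" where
  "dsrc G (e, b) = (if b then src G e else tgt G e)"

fun dtgt :: "'e web \<Rightarrow> 'e dedge \<Rightarrow> complex" where
  "dtgt G (e, b) = (if b then tgt G e else src G e)"

fun dpath :: "'e web \<Rightarrow> 'e dedge \<Rightarrow> real \<Rightarrow> complex" where
  "dpath G (e, b) = (if b then curve G e else reversepath (curve G e))"

text \<open>Requiring distinct edges excludes the closed walk that runs along one edge and back.\<close>

definition walk :: "'e web \<Rightarrow> 'e dedge list \<Rightarrow> bool" where
  "walk G ds \<longleftrightarrow>
     ds \<noteq> [] \<and> fst ` set ds \<subseteq> edges G \<and> distinct (map fst ds) \<and>
     successively (\<lambda>d d'. dtgt G d = dsrc G d') ds"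

definition open_walk :: "'e web \<Rightarrow> 'e dedge list \<Rightarrow> bool" where
  "open_walk G ds \<longleftrightarrow>
     walk G ds \<and> distinct (map (dsrc G) ds @ [dtgt G (last ds)]) \<and>
     dsrc G (hd ds) \<in> boundary_verts G \<and> dtgt G (last ds) \<in> boundary_verts G"

definition closed_walk :: "'e web \<Rightarrow> 'e dedge list \<Rightarrow> bool" where
  "closed_walk G ds \<longleftrightarrow>
     walk G ds \<and> distinct (map (dsrc G) ds) \<and> dtgt G (last ds) = dsrc G (hd ds)"

definition walk_path :: "'e web \<Rightarrow> 'e dedge list \<Rightarrow> real \<Rightarrow> complex" where
  "walk_path G ds = foldl (\<lambda>p d. p +++ dpath G d) (dpath G (hd ds)) (tl ds)"

definition open_curve :: "'e web \<Rightarrow> 'e dedge set \<Rightarrow> bool" where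
  "open_curve G C \<longleftrightarrow> (\<exists>ds. open_walk G ds \<and> set ds = C)"

definition closed_curve :: "'e web \<Rightarrow> 'e dedge set \<Rightarrow> bool" where
  "closed_curve G C \<longleftrightarrow> (\<exists>ds. closed_walk G ds \<and> set ds = C)"

definition clockwise_open :: "'e web \<Rightarrow> 'e dedge set \<Rightarrow> bool" where
  "clockwise_open G C \<longleftrightarrow>
     (\<exists>ds. open_walk G ds \<and> set ds = C \<and> Re (dtgt G (last ds)) < Re (dsrc G (hd ds)))"

definition counterclockwise_open :: "'e web \<Rightarrow> 'e dedge set \<Rightarrow> bool" where
  "counterclockwise_open G C \<longleftrightarrow>
     (\<exists>ds. open_walk G ds \<and> set ds = C \<and> Re (dsrc G (hd ds)) < Re (dtgt G (last ds)))"

definition clockwise_closed :: "'e web \<Rightarrow> 'e dedge set \<Rightarrow> bool" where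
  "clockwise_closed G C \<longleftrightarrow>
     (\<exists>ds. closed_walk G ds \<and> set ds = C \<and>
        (\<forall>z\<in>inside (path_image (walk_path G ds)). winding_number (walk_path G ds) z = - 1))"

definition counterclockwise_closed :: "'e web \<Rightarrow> 'e dedge set \<Rightarrow> bool" where
  "counterclockwise_closed G C \<longleftrightarrow>
     (\<exists>ds. closed_walk G ds \<and> set ds = C \<and>
        (\<forall>z\<in>inside (path_image (walk_path G ds)). winding_number (walk_path G ds) z = 1))"

definition trace_of :: "'e web \<Rightarrow> 'e dedge set \<Rightarrow> complex set" where
  "trace_of G C = (\<Union>e\<in>fst ` C. path_image (curve G e))"


section \<open>Strandings\<close>

text \<open>A stranding is the set of its coloured simple strands \<open>(c, C)\<close>.\<close>

type_synonym 'e stranding = "(nat \<times> 'e dedge set) set"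

definition is_stranding :: "nat \<Rightarrow> 'e web \<Rightarrow> 'e stranding \<Rightarrow> bool" where
  "is_stranding n G S \<longleftrightarrow>
     (\<forall>(c, C)\<in>S. c \<in> {1..n-1} \<and> (open_curve G C \<or> closed_curve G C)) \<and>
     (\<forall>(c, C)\<in>S. \<forall>(d, D)\<in>S. c = d \<and> C \<noteq> D \<longrightarrow> trace_of G C \<inter> trace_of G D = {})"

definition colors_pos :: "'e stranding \<Rightarrow> 'e \<Rightarrow> nat set" where
  "colors_pos S e = {c. \<exists>C. (c, C) \<in> S \<and> (e, True) \<in> C}"

definition colors_neg :: "'e stranding \<Rightarrow> 'e \<Rightarrow> nat set" where
  "colors_neg S e = {c. \<exists>C. (c, C) \<in> S \<and> (e, False) \<in> C}"

definition colors :: "'e stranding \<Rightarrow> 'e \<Rightarrow> nat set" where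
  "colors S e = colors_pos S e \<union> colors_neg S e"

definition coroot :: "'e stranding \<Rightarrow> 'e \<Rightarrow> nat \<Rightarrow> int" where
  "coroot S e c = (if c \<in> colors_pos S e then 1 else if c \<in> colors_neg S e then -1 else 0)"

text \<open>
  The second condition refers to the largest colour on \<open>e\<close>, hence includes that \<open>e\<close> carries some
  colour.
\<close>

definition valid_on :: "nat \<Rightarrow> 'e web \<Rightarrow> 'e stranding \<Rightarrow> 'e \<Rightarrow> bool" where
  "valid_on n G S e \<longleftrightarrow>
     (\<forall>c\<in>colors S e. \<forall>d\<in>colors S e.
        c < d \<and> colors S e \<inter> {c<..<d} = {} \<longrightarrow> coroot S e d = - coroot S e c) \<and>
     colors S e \<noteq> {} \<and>
     (\<Sum>c\<in>{1..n-1}. coroot S e c * int c) =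
       (if Max (colors S e) \<in> colors_pos S e then int (weight G e) else int (weight G e) - int n)"

definition strandings :: "nat \<Rightarrow> 'e web \<Rightarrow> 'e stranding set" where
  "strandings n G = {S. is_stranding n G S \<and> (\<forall>e\<in>edges G. valid_on n G S e)}"

text \<open>
  \<open>strand_bit n S e i\<close> is the entry \<open>b\<^sub>i\<close> of the binary vector of \<open>e\<close> for \<open>1 \<le> i \<le> n\<close>: the recursion
  \<open>b\<^sub>c - b\<^bsub>c+1\<^esub> = coroot S e c\<close> is solved downwards from the prescribed value of \<open>b\<^sub>n\<close>.
\<close>

definition strand_bit :: "nat \<Rightarrow> 'e stranding \<Rightarrow> 'e \<Rightarrow> nat \<Rightarrow> int" where
  "strand_bit n S e i =
     (if Max (colors S e) \<in> colors_pos S e then 0 else 1) + (\<Sum>c\<in>{i..<n}. coroot S e c)"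

lemma strand_bit_top: "strand_bit n S e n = (if Max (colors S e) \<in> colors_pos S e then 0 else 1)"
  by (simp add: strand_bit_def)

lemma strand_bit_step: "c < n \<Longrightarrow> strand_bit n S e c - strand_bit n S e (Suc c) = coroot S e c"
  by (simp add: strand_bit_def sum.atLeast_Suc_lessThan)

lemma finite_strandings:
  assumes "finite (edges G)"
  shows "finite (strandings n G)"
proof (rule finite_subset)
  show "strandings n G \<subseteq> Pow ({1..n-1} \<times> Pow (edges G \<times> UNIV))"
    by (fastforce simp: strandings_def is_stranding_def open_curve_def closed_curve_def
        open_walk_def closed_walk_def walk_def)
  show "finite (Pow ({1..n-1} \<times> Pow (edges G \<times> (UNIV :: bool set))))"
    using assms by simp
qed


section \<open>Strands of type \<open>(i, j)\<close>\<close>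

definition strand_dedges :: "nat \<Rightarrow> 'e web \<Rightarrow> 'e stranding \<Rightarrow> nat \<Rightarrow> nat \<Rightarrow> 'e dedge set" where
  "strand_dedges n G S i j =
     {(e, True) | e. e \<in> edges G \<and> strand_bit n S e i - strand_bit n S e j = 1} \<union>
     {(e, False) | e. e \<in> edges G \<and> strand_bit n S e i - strand_bit n S e j = - 1}"

text \<open>Connected components of a set of directed edges, two of them being adjacent if they share a vertex.\<close>

definition adjacency :: "'e web \<Rightarrow> 'e dedge set \<Rightarrow> 'e dedge rel" where
  "adjacency G L =
     {(d, d') \<in> L \<times> L. {dsrc G d, dtgt G d} \<inter> {dsrc G d', dtgt G d'} \<noteq> {}}"

definition curve_components :: "'e web \<Rightarrow> 'e dedge set \<Rightarrow> 'e dedge set set" where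
  "curve_components G L = L // ((adjacency G L)\<^sup>+)"

definition strands :: "nat \<Rightarrow> 'e web \<Rightarrow> 'e stranding \<Rightarrow> nat \<Rightarrow> nat \<Rightarrow> 'e dedge set set" where
  "strands n G S i j = curve_components G (strand_dedges n G S i j)"

definition cw :: "nat \<Rightarrow> 'e web \<Rightarrow> 'e stranding \<Rightarrow> nat" where
  "cw n G S = card {(i, j, C). 1 \<le> i \<and> i < j \<and> j \<le> n \<and> C \<in> strands n G S i j \<and>
     clockwise_closed G C}"

definition ccw :: "nat \<Rightarrow> 'e web \<Rightarrow> 'e stranding \<Rightarrow> nat" where
  "ccw n G S = card {(i, j, C). 1 \<le> i \<and> i < j \<and> j \<le> n \<and> C \<in> strands n G S i j \<and>
     (counterclockwise_open G C \<or> counterclockwise_closed G C)}"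


section \<open>The web vector and its leading term\<close>

text \<open>
  A monomial \<open>x\<^bsub>b\<^sub>1\<^esub> \<otimes> \<dots> \<otimes> x\<^bsub>b\<^sub>m\<^esub>\<close> is represented by the list \<open>[b\<^sub>1, \<dots>, b\<^sub>m]\<close> of its 0-1 vectors (each
  a list of length \<open>n\<close>), and vectors of \<open>V\<^sub>n(k)\<close> by finitely supported functions from monomials to
  the rational function field in \<open>q\<close> over the complex numbers.
\<close>

type_synonym monomial = "int list list"

type_synonym ratfun = "complex poly fract"

definition qvar :: ratfun where
  "qvar = Fract [:0, 1:] 1"

definition boundary_bits :: "nat \<Rightarrow> 'e web \<Rightarrow> 'e stranding \<Rightarrow> complex \<Rightarrow> int list" where
  "boundary_bits n G S v =
     (let e = boundary_edge G v
      in map (\<lambda>i. if tgt G e = v then strand_bit n S e i else 1 - strand_bit n S e i) [1..<Suc n])"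

definition stranding_monomial :: "nat \<Rightarrow> 'e web \<Rightarrow> 'e stranding \<Rightarrow> monomial" where
  "stranding_monomial n G S = map (boundary_bits n G S) (boundary_list G)"

definition web_vector :: "nat \<Rightarrow> 'e web \<Rightarrow> monomial \<Rightarrow>\<^sub>0 ratfun" where
  "web_vector n G =
     (\<Sum>S\<in>strandings n G. Poly_Mapping.single (stranding_monomial n G S)
        ((- qvar) powi (int (cw n G S) - int (ccw n G S))))"

definition ones_seq :: "int list \<Rightarrow> nat list" where
  "ones_seq b = filter (\<lambda>i. b ! (i - 1) = 1) [1..<Suc (length b)]"

definition monomial_less :: "monomial \<Rightarrow> monomial \<Rightarrow> bool" (infix "\<prec>" 50) where
  "x \<prec> y \<longleftrightarrow> (concat (map ones_seq x), concat (map ones_seq y)) \<in> lexord {(a, b). a < b}"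

text \<open>\<open>leading_term w x\<close> says that \<open>w\<close> is nonzero and \<open>lt(w) = x\<close>.\<close>

definition leading_term :: "(monomial \<Rightarrow>\<^sub>0 ratfun) \<Rightarrow> monomial \<Rightarrow> bool" where
  "leading_term w x \<longleftrightarrow> x \<in> Poly_Mapping.keys w \<and> (\<forall>y\<in>Poly_Mapping.keys w. y \<noteq> x \<longrightarrow> x \<prec> y)"

definition leading_term_stranding :: "nat \<Rightarrow> 'e web \<Rightarrow> 'e stranding \<Rightarrow> bool" where
  "leading_term_stranding n G S \<longleftrightarrow>
     S \<in> strandings n G \<and> leading_term (web_vector n G) (stranding_monomial n G S)"

end

theory Submission
  imports Defs
begin

text \<open>
  Suppose an open \<open>(i, j)\<close>-strand \<open>C\<close> of the stranding were counterclockwise.  Exchanging \<open>b\<^sub>i\<close> and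
  \<open>b\<^sub>j\<close> on every edge of \<open>C\<close> reverses it and gives the binary vectors of another valid stranding.
  The boundary vectors first change at the left end of \<open>C\<close>, where a one moves from position \<open>j\<close> to
  position \<open>i\<close>, so the new monomial is smaller.  No cancellation can remove it from the web
  vector: all coefficients are sums of powers of \<open>-q\<close>, and at \<open>q = -1\<close> such a sum counts its terms.
\<close>

section \<open>Coefficients of the web vector\<close>

text \<open>Reversing an \<open>(i, j)\<close>-strand breaks simple strands of several colours apart
  and reconnects them, so validity of the result is hard to follow on the curves themselves. On
  binary vectors it is easy. Alternation and the weight condition say that each edge carries a 0-1
  vector with \<open>weight G e\<close> ones, and the curves leave only one trace: at an interior
  vertex the net flow of the \<open>i\<close>-th bits does not depend on \<open>i\<close>. This
  condition is symmetric in the positions, which is why exchanging two of them can preserve it. The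
  price is the way back, where curves have to be rebuilt from bits: the flow of each colour must
  split into pairwise disjoint arcs and loops, and this is what trivalence of the interior vertices
  provides.\<close>

lemma qvar_nonzero: "- qvar \<noteq> 0"
  by (simp add: qvar_def Zero_fract_def eq_fract)

lemma qvar_power: "(- qvar) ^ m = Fract ((- [:0, 1:]) ^ m) 1"
  by (induction m) (simp_all add: qvar_def One_fract_def)

lemma sum_Fract_1: "(\<Sum>s\<in>A. Fract (p s) 1) = Fract (\<Sum>s\<in>A. p s) (1 :: 'a::idom)"
  by (induction A rule: infinite_finite_induct) (simp_all add: Zero_fract_def)

lemma Fract_0_iff: "Fract p (1 :: 'a::idom) = 0 \<longleftrightarrow> p = 0"
  unfolding Zero_fract_def by (subst eq_fract) simp_all

lemma sum_qvar_powi_nonzero: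
  fixes f :: "'s \<Rightarrow> int"
  assumes "finite A" "A \<noteq> {}"
  shows "(\<Sum>s\<in>A. (- qvar) powi f s) \<noteq> 0"
proof
  assume 0: "(\<Sum>s\<in>A. (- qvar) powi f s) = 0"
  \<comment> \<open>Multiplying by \<open>(- qvar) ^ N\<close> makes all exponents nonnegative at
    once; the sum becomes a polynomial, which can be evaluated at -1.\<close>
  define N where "N = (\<Sum>s\<in>A. nat \<bar>f s\<bar>)"
  have N: "0 \<le> f s + int N" if "s \<in> A" for s
  proof -
    have "nat \<bar>f s\<bar> \<le> N"
      unfolding N_def using that assms(1) by (intro member_le_sum) auto
    then show ?thesis by linarith
  qed
  have "(- qvar) powi f s * (- qvar) ^ N = Fract ((- [:0, 1:]) ^ nat (f s + int N)) 1"
    if "s \<in> A" for s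
  proof -
    have "(- qvar) powi f s * (- qvar) ^ N = (- qvar) powi (f s + int N)"
      using qvar_nonzero by (simp add: power_int_add)
    also have "\<dots> = (- qvar) ^ nat (f s + int N)"
      using N[OF that] by (simp add: power_int_def)
    finally show ?thesis by (simp add: qvar_power)
  qed
  then have "(\<Sum>s\<in>A. (- qvar) powi f s) * (- qvar) ^ N =
      Fract (\<Sum>s\<in>A. (- [:0, 1:]) ^ nat (f s + int N)) 1"
    by (simp add: sum_distrib_right sum_Fract_1)
  with 0 have "Fract (\<Sum>s\<in>A. (- [:0, 1:]) ^ nat (f s + int N)) 1 = (0 :: ratfun)"
    by simp
  then have "(\<Sum>s\<in>A. (- [:0, 1:]) ^ nat (f s + int N)) = (0 :: complex poly)"
    by (simp add: Fract_0_iff)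
  then have "poly (\<Sum>s\<in>A. (- [:0, 1:]) ^ nat (f s + int N)) (-1 :: complex) = 0"
    by simp
  then have "of_nat (card A) = (0 :: complex)"
    by (simp add: poly_sum)
  with assms show False by simp
qed

lemma keys_web_vector:
  assumes "finite (edges G)" "S \<in> strandings n G"
  shows "stranding_monomial n G S \<in> Poly_Mapping.keys (web_vector n G)"
proof -
  let ?A = "{T \<in> strandings n G. stranding_monomial n G T = stranding_monomial n G S}"
  have fin: "finite (strandings n G)"
    using assms(1) by (rule finite_strandings)
  have "Poly_Mapping.lookup (web_vector n G) (stranding_monomial n G S) =
      (\<Sum>T\<in>?A. (- qvar) powi (int (cw n G T) - int (ccw n G T)))"
    unfolding web_vector_def lookup_sum lookup_single when_def
    using fin by (intro sum.inter_filter[symmetric])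
  moreover have "\<dots> \<noteq> 0"
    using fin assms(2) by (intro sum_qvar_powi_nonzero) auto
  ultimately show ?thesis
    by (simp add: in_keys_iff)
qed

section \<open>Binary labellings\<close>

text \<open>Inflow minus outflow at \<open>v\<close>, with \<open>f\<close> counted along the
  direction of each edge. A loop edge at \<open>v\<close> contributes 0.\<close>

definition net :: "'e web \<Rightarrow> ('e \<Rightarrow> int) \<Rightarrow> complex \<Rightarrow> int" where
  "net G f v = (\<Sum>e\<in>edges G. f e * (of_bool (tgt G e = v) - of_bool (src G e = v)))"

text \<open>
  The last condition says that for each colour \<open>c\<close> the flow \<open>b\<^sub>c - b\<^bsub>c+1\<^esub>\<close> is conserved at interior
  vertices.  Labellings are exactly the families of binary vectors of valid strandings.
\<close>

definition labelling :: "nat \<Rightarrow> 'e web \<Rightarrow> ('e \<Rightarrow> nat \<Rightarrow> int) \<Rightarrow> bool" where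
  "labelling n G b \<longleftrightarrow>
     (\<forall>e\<in>edges G. (\<forall>i\<in>{1..n}. b e i \<in> {0, 1}) \<and> (\<Sum>i=1..n. b e i) = int (weight G e)) \<and>
     (\<forall>v\<in>interior_verts G. \<forall>i\<in>{1..n}. \<forall>j\<in>{1..n}.
        net G (\<lambda>e. b e i) v = net G (\<lambda>e. b e j) v)"

text \<open>The sum telescopes: the target of each directed edge cancels against the source of the
  next.\<close>

lemma walk_flux:
  assumes "successively (\<lambda>d d'. dtgt G d = dsrc G d') ds" "ds \<noteq> []"
  shows "(\<Sum>d\<leftarrow>ds. of_bool (dtgt G d = v) - of_bool (dsrc G d = v)) =
    (of_bool (dtgt G (last ds) = v) - of_bool (dsrc G (hd ds) = v) :: int)"
  using assms
proof (induction ds)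
  case (Cons d ds)
  then show ?case by (cases ds) auto
qed simp

text \<open>By \<open>walk_flux\<close> only the two ends of the walk contribute. For an arc they
  lie on the boundary axis, for a loop they cancel.\<close>

lemma net_curve:
  assumes "open_curve G C \<or> closed_curve G C" "v \<in> interior_verts G" "finite (edges G)"
  shows "net G (\<lambda>e. of_bool ((e, True) \<in> C) - of_bool ((e, False) \<in> C)) v = 0"
proof -
  obtain ds where ds: "walk G ds" "set ds = C"
    and ends: "open_walk G ds \<or> closed_walk G ds"
    using assms(1) by (auto simp: open_curve_def closed_curve_def open_walk_def closed_walk_def)
  let ?g = "\<lambda>d. of_bool (dtgt G d = v) - of_bool (dsrc G d = v) :: int"
  have C: "C \<subseteq> edges G \<times> UNIV"
    using ds by (auto simp: walk_def)
  have dist: "distinct ds"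
    using ds by (simp add: walk_def distinct_map)
  have "(\<Sum>d\<in>C. ?g d) = (\<Sum>d\<leftarrow>ds. ?g d)"
    using ds dist by (simp add: sum_list_distinct_conv_sum_set)
  also have "\<dots> = of_bool (dtgt G (last ds) = v) - of_bool (dsrc G (hd ds) = v)"
    using ds by (intro walk_flux) (auto simp: walk_def)
  also have "\<dots> = 0"
    using ends assms(2)
    by (auto simp: open_walk_def closed_walk_def boundary_verts_def interior_verts_def)
  finally have 0: "(\<Sum>d\<in>C. ?g d) = 0" .
  have "(\<Sum>d\<in>C. ?g d) = (\<Sum>d\<in>edges G \<times> UNIV. of_bool (d \<in> C) * ?g d)"
    using C assms(3) by (intro sum.mono_neutral_cong_left) auto
  also have "\<dots> = (\<Sum>e\<in>edges G. \<Sum>s\<in>UNIV. of_bool ((e, s) \<in> C) * ?g (e, s))"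
    unfolding sum.cartesian_product by (intro sum.cong refl) (simp only: split_paired_all prod.case)
  also have "\<dots> = net G (\<lambda>e. of_bool ((e, True) \<in> C) - of_bool ((e, False) \<in> C)) v"
    unfolding net_def by (intro sum.cong refl) (auto simp: UNIV_bool of_bool_def)
  finally show ?thesis using 0 by simp
qed

lemma curve_edges:
  assumes "open_curve G C \<or> closed_curve G C"
  shows "fst ` C \<subseteq> edges G" "\<not> ((e, True) \<in> C \<and> (e, False) \<in> C)"
proof -
  obtain ds where ds: "walk G ds" "set ds = C"
    using assms by (auto simp: open_curve_def closed_curve_def open_walk_def closed_walk_def)
  then show "fst ` C \<subseteq> edges G" by (auto simp: walk_def)
  have "inj_on fst C" using ds by (auto simp: walk_def distinct_map)
  then show "\<not> ((e, True) \<in> C \<and> (e, False) \<in> C)"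
    using inj_onD[of fst C "(e, True)" "(e, False)"] by auto
qed

lemma finite_color_class:
  assumes "is_stranding n G S" "finite (edges G)"
  shows "finite {C. (c, C) \<in> S}"
proof (rule finite_subset)
  show "{C. (c, C) \<in> S} \<subseteq> Pow (edges G \<times> UNIV)"
    using assms(1) curve_edges(1) by (fastforce simp: is_stranding_def)
qed (use assms in simp)

text \<open>Simple strands of one colour have disjoint traces, so at most one of them runs along
  \<open>e\<close> and the sum has at most one nonzero term. In this form conservation can be summed
  over strands.\<close>

lemma coroot_eq_sum:
  assumes S: "is_stranding n G S" and fin: "finite (edges G)" and e: "e \<in> edges G"
  shows "coroot S e c =
    (\<Sum>C | (c, C) \<in> S. of_bool ((e, True) \<in> C) - of_bool ((e, False) \<in> C))"
proof (cases "\<exists>C. (c, C) \<in> S \<and> e \<in> fst ` C")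
  case False
  then have "(e, s) \<notin> C" if "(c, C) \<in> S" for C s
    using that by force
  then show ?thesis
    by (auto simp: coroot_def colors_pos_def colors_neg_def)
next
  case True
  then obtain C0 where C0: "(c, C0) \<in> S" "e \<in> fst ` C0" by blast
  have uniq: "C = C0" if "(c, C) \<in> S" "e \<in> fst ` C" for C
  proof (rule ccontr)
    assume "C \<noteq> C0"
    then have "trace_of G C \<inter> trace_of G C0 = {}"
      using S C0 that by (fastforce simp: is_stranding_def)
    moreover have "src G e \<in> trace_of G C \<inter> trace_of G C0"
      using C0 that pathstart_in_path_image[of "curve G e"] unfolding trace_of_def src_def
      by (intro IntI UN_I)
    ultimately show False by blast
  qed
  have curve: "open_curve G C0 \<or> closed_curve G C0"
    using S C0 by (auto simp: is_stranding_def)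
  have same: "C = C0" if "(c, C) \<in> S" "(e, s) \<in> C" for C s
    using uniq[OF that(1)] image_eqI[of e fst "(e, s)" C] that(2) by simp
  have pos: "c \<in> colors_pos S e \<longleftrightarrow> (e, True) \<in> C0" and neg: "c \<in> colors_neg S e \<longleftrightarrow> (e, False) \<in> C0"
    using C0(1) same unfolding colors_pos_def colors_neg_def by blast+
  have "(\<Sum>C | (c, C) \<in> S. of_bool ((e, True) \<in> C) - of_bool ((e, False) \<in> C)) =
      (\<Sum>C\<in>{C0}. of_bool ((e, True) \<in> C) - of_bool ((e, False) \<in> C) :: int)"
  proof (rule sum.mono_neutral_right[OF finite_color_class[OF S fin]])
    have "(e, s) \<notin> C" if "(c, C) \<in> S" "C \<noteq> C0" for C s
      using same[OF that(1)] that(2) by blast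
    then show "\<forall>C\<in>{C. (c, C) \<in> S} - {C0}.
        of_bool ((e, True) \<in> C) - of_bool ((e, False) \<in> C) = (0 :: int)"
      by simp
  qed (use C0 in simp)
  then show ?thesis
    using curve_edges(2)[OF curve, of e] by (auto simp: coroot_def pos neg)
qed

lemma net_sum: "net G (\<lambda>e. \<Sum>c\<in>A. f c e) v = (\<Sum>c\<in>A. net G (f c) v)"
  unfolding net_def sum_distrib_right by (rule sum.swap)

lemma net_cong: "(\<And>e. e \<in> edges G \<Longrightarrow> tgt G e = v \<or> src G e = v \<Longrightarrow> f e = g e) \<Longrightarrow> net G f v = net G g v"
  unfolding net_def by (intro sum.cong) auto

lemma net_coroot:
  assumes "is_stranding n G S" "finite (edges G)" "v \<in> interior_verts G"
  shows "net G (\<lambda>e. coroot S e c) v = 0"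
proof -
  have "net G (\<lambda>e. coroot S e c) v =
      net G (\<lambda>e. \<Sum>C | (c, C) \<in> S. of_bool ((e, True) \<in> C) - of_bool ((e, False) \<in> C)) v"
    using coroot_eq_sum[OF assms(1,2)] by (intro net_cong)
  also have "\<dots> = 0"
    using assms by (auto simp: net_sum is_stranding_def intro!: sum.neutral net_curve)
  finally show ?thesis .
qed

text \<open>Summation by parts. With \<open>b n\<close> equal to 0 or 1, the right-hand side gives
  the two cases of the weight condition for validity, so that condition just counts the ones of
  \<open>b\<close>.\<close>

lemma weighted_telescope:
  fixes b :: "nat \<Rightarrow> int"
  assumes "n \<ge> 1"
  shows "(\<Sum>c\<in>{1..n-1}. (b c - b (Suc c)) * int c) = (\<Sum>i=1..n. b i) - int n * b n"
  using assms
proof (induction n rule: dec_induct)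
  case (step m)
  have "{1..Suc m - 1} = insert m {1..m-1}"
    using step by auto
  then show ?case
    using step by (simp add: algebra_simps)
qed simp

text \<open>Downward induction on \<open>i\<close>: the bit at \<open>i\<close> depends only on the
  sign of the first colour at or above \<open>i\<close>, because alternating signs make the partial
  sums from the top switch between 0 and 1. The second conjunct treats positions above all
  colours.\<close>

lemma strand_bit_alternating:
  assumes valid: "valid_on n G S e" and cols: "colors S e \<subseteq> {1..n-1}" and "i \<le> n"
  shows "(\<forall>c\<in>colors S e. i \<le> c \<and> colors S e \<inter> {i..<c} = {} \<longrightarrow>
            strand_bit n S e i = of_bool (coroot S e c = 1)) \<and>
         (colors S e \<inter> {i..} = {} \<longrightarrow> strand_bit n S e i = strand_bit n S e n)"
  using \<open>i \<le> n\<close>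
proof (induction i rule: inc_induct)
  case base
  then show ?case using cols by fastforce
next
  case (step i)
  let ?T = "colors S e"
  have fin: "finite ?T" using cols by (rule finite_subset) simp
  have bit: "strand_bit n S e i = coroot S e i + strand_bit n S e (Suc i)"
    using strand_bit_step[OF step.hyps(2), of S e] by simp
  show ?case
  proof (cases "i \<in> ?T")
    case False
    then have "strand_bit n S e i = strand_bit n S e (Suc i)"
      using bit by (simp add: coroot_def colors_def)
    moreover have "?T \<inter> {i..<c} = ?T \<inter> {Suc i..<c}" "?T \<inter> {i..} = ?T \<inter> {Suc i..}" for c
      using False by (auto simp: le_eq_less_or_eq Suc_le_eq)
    moreover have "i \<le> c \<longleftrightarrow> Suc i \<le> c" if "c \<in> ?T" for c
      using False that by (auto simp: le_eq_less_or_eq Suc_le_eq)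
    ultimately show ?thesis using step.IH by auto
  next
    case True
    then have pm: "coroot S e i = 1 \<or> coroot S e i = -1"
      by (auto simp: coroot_def colors_def)
    have "strand_bit n S e i = of_bool (coroot S e i = 1)"
    proof (cases "?T \<inter> {Suc i..} = {}")
      case True
      \<comment> \<open>At the largest colour the top bit is chosen opposite to the sign: 0 below a
        coroot of 1, and 1 below a coroot of -1.\<close>
      then have "Max ?T = i"
        using \<open>i \<in> ?T\<close> fin by (intro Max_eqI) (auto simp: not_less_eq_eq[symmetric])
      moreover have "strand_bit n S e (Suc i) = strand_bit n S e n"
        using step.IH True by blast
      ultimately show ?thesis
        using bit pm by (auto simp: strand_bit_top coroot_def split: if_splits)
    next
      case False
      \<comment> \<open>The next colour above \<open>i\<close>; by alternation it has the opposite
        sign, so the bit just above \<open>i\<close> again leaves room for the step at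
        \<open>i\<close>.\<close>
      define c where "c = Min (?T \<inter> {Suc i..})"
      have c: "c \<in> ?T \<inter> {Suc i..}"
        unfolding c_def using False fin by (intro Min_in) auto
      have gap: "?T \<inter> {Suc i..<c} = {}"
      proof -
        have le: "c \<le> x" if "x \<in> ?T" "Suc i \<le> x" for x
          unfolding c_def using fin that by (intro Min_le) auto
        show ?thesis by (auto dest: le)
      qed
      then have "strand_bit n S e (Suc i) = of_bool (coroot S e c = 1)"
        using c step.IH by auto
      moreover have "coroot S e c = - coroot S e i"
        using valid True c gap unfolding valid_on_def
        by (metis IntD1 IntD2 atLeastSucLessThan_greaterThanLessThan atLeast_iff Suc_le_eq)
      ultimately show ?thesis using bit pm by auto
    qed
    moreover have "c = i" if "i \<le> c" "?T \<inter> {i..<c} = {}" for c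
      using that True by force
    moreover have "?T \<inter> {i..} \<noteq> {}" using True by auto
    ultimately show ?thesis by blast
  qed
qed

lemma colors_stranding:
  assumes "is_stranding n G S"
  shows "colors S e \<subseteq> {1..n-1}"
  using assms by (fastforce simp: is_stranding_def colors_def colors_pos_def colors_neg_def)

lemma strand_bit_binary:
  assumes "valid_on n G S e" "colors S e \<subseteq> {1..n-1}" "i \<le> n"
  shows "strand_bit n S e i \<in> {0, 1}"
proof (cases "colors S e \<inter> {i..} = {}")
  case True
  then show ?thesis
    using strand_bit_alternating[OF assms] by (auto simp: strand_bit_top)
next
  case False
  define c where "c = Min (colors S e \<inter> {i..})"
  have fin: "finite (colors S e)" using assms(2) by (rule finite_subset) simp
  then have "c \<in> colors S e \<inter> {i..}"
    unfolding c_def using False by (intro Min_in) auto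
  moreover have "colors S e \<inter> {i..<c} = {}"
  proof -
    have le: "c \<le> x" if "x \<in> colors S e" "i \<le> x" for x
      unfolding c_def using fin that by (intro Min_le) auto
    show ?thesis by (auto dest: le)
  qed
  ultimately show ?thesis
    using strand_bit_alternating[OF assms] by auto
qed

lemma labelling_strand_bit:
  assumes S: "S \<in> strandings n G" and fin: "finite (edges G)" and n: "n \<ge> 1"
  shows "labelling n G (strand_bit n S)"
  unfolding labelling_def
proof (intro conjI ballI)
  have st: "is_stranding n G S" using S by (simp add: strandings_def)
  fix e assume "e \<in> edges G"
  then have val: "valid_on n G S e" using S by (simp add: strandings_def)
  show "strand_bit n S e i \<in> {0, 1}" if "i \<in> {1..n}" for i
    using strand_bit_binary[OF val colors_stranding[OF st]] that by simp
  have "(\<Sum>c\<in>{1..n-1}. coroot S e c * int c) =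
      (\<Sum>c\<in>{1..n-1}. (strand_bit n S e c - strand_bit n S e (Suc c)) * int c)"
    using n by (intro sum.cong) (auto simp: strand_bit_step)
  then have "(\<Sum>i=1..n. strand_bit n S e i) =
      (\<Sum>c\<in>{1..n-1}. coroot S e c * int c) + int n * strand_bit n S e n"
    using weighted_telescope[OF n, of "strand_bit n S e"] by simp
  with val show "(\<Sum>i=1..n. strand_bit n S e i) = int (weight G e)"
    by (simp add: valid_on_def strand_bit_top)
next
  have st: "is_stranding n G S" using S by (simp add: strandings_def)
  fix v i j assume v: "v \<in> interior_verts G"
  \<comment> \<open>The coroots at and above \<open>k\<close> have no net flow at \<open>v\<close>;
    what remains is the flow of the top bit, which does not mention \<open>k\<close>.\<close>
  have "net G (\<lambda>e. strand_bit n S e k) v =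
      net G (\<lambda>e. if Max (colors S e) \<in> colors_pos S e then 0 else 1) v" for k
  proof -
    have "net G (\<lambda>e. strand_bit n S e k) v =
        net G (\<lambda>e. if Max (colors S e) \<in> colors_pos S e then 0 else 1) v +
        net G (\<lambda>e. \<Sum>c\<in>{k..<n}. coroot S e c) v"
      unfolding strand_bit_def net_def by (simp add: distrib_right sum.distrib)
    then show ?thesis
      by (simp add: net_sum net_coroot[OF st fin v])
  qed
  then show "net G (\<lambda>e. strand_bit n S e i) v = net G (\<lambda>e. strand_bit n S e j) v"
    by simp
qed

section \<open>Decomposing a flow into arcs and loops\<close>

definition flow_dedges :: "'e web \<Rightarrow> ('e \<Rightarrow> int) \<Rightarrow> 'e dedge set" where
  "flow_dedges G a = {(e, True) | e. e \<in> edges G \<and> a e = 1} \<union> {(e, False) | e. e \<in> edges G \<and> a e = -1}"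

text \<open>The combinatorial form of a disjoint union of directed paths and cycles: at most one
  edge in and one out at each vertex, no edge used both ways, and paths ending only at the
  boundary.\<close>

definition flow :: "'e web \<Rightarrow> 'e dedge set \<Rightarrow> bool" where
  "flow G L \<longleftrightarrow> fst ` L \<subseteq> edges G \<and> finite L \<and> inj_on fst L \<and>
     inj_on (dsrc G) L \<and> inj_on (dtgt G) L \<and>
     (\<forall>v\<in>interior_verts G. v \<in> dsrc G ` L \<longleftrightarrow> v \<in> dtgt G ` L)"

section \<open>Components of a flow are arcs or loops\<close>

lemma equiv_adjacency: "equiv L ((adjacency G L)\<^sup>+)"
proof (rule equivI)
  show "(adjacency G L)\<^sup>+ \<subseteq> L \<times> L"
    by (rule trancl_subset_Sigma) (auto simp: adjacency_def)
  show "refl_on L ((adjacency G L)\<^sup>+)"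
    by (rule refl_onI) (auto simp: adjacency_def)
  have "sym (adjacency G L)"
    by (rule symI) (auto simp: adjacency_def)
  then show "sym ((adjacency G L)\<^sup>+)"
    by (rule sym_trancl)
qed (rule trans_trancl)

lemma Union_curve_components: "\<Union> (curve_components G L) = L"
  unfolding curve_components_def by (rule Union_quotient[OF equiv_adjacency])

lemma curve_component_closed:
  assumes "C \<in> curve_components G L" "d \<in> C" "d' \<in> L"
    and "{dsrc G d, dtgt G d} \<inter> {dsrc G d', dtgt G d'} \<noteq> {}"
  shows "d' \<in> C"
proof -
  have "d \<in> L" using assms(1,2) Union_curve_components[of G L] by blast
  with assms(3,4) have "(d, d') \<in> (adjacency G L)\<^sup>+"
    by (auto simp: adjacency_def)
  then show ?thesis
    using in_quotient_imp_closed[OF equiv_adjacency] assms(1,2)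
    unfolding curve_components_def by metis
qed

lemma successively_trancl:
  assumes "successively R ds" "\<And>d d'. d \<in> set ds \<Longrightarrow> d' \<in> set ds \<Longrightarrow> R d d' \<Longrightarrow> (d, d') \<in> r"
    and "ds \<noteq> []" "x \<in> set ds" "\<And>d. d \<in> set ds \<Longrightarrow> (d, d) \<in> r\<^sup>+"
  shows "(hd ds, x) \<in> r\<^sup>+"
  using assms
proof (induction ds)
  case (Cons d ds)
  show ?case
  proof (cases "x = d")
    case False
    then have x: "x \<in> set ds" and ne: "ds \<noteq> []" using Cons.prems by auto
    then have "(hd ds, x) \<in> r\<^sup>+"
      using Cons.prems by (intro Cons.IH) (auto simp: successively_Cons)
    moreover have "(d, hd ds) \<in> r"
      using Cons.prems(1) ne by (intro Cons.prems(2)) (auto simp: successively_Cons)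
    ultimately show ?thesis by simp
  qed (use Cons.prems in simp)
qed simp

lemma curve_component_curve:
  assumes L: "flow G L" and web: "half_plane_graph G" and C: "C \<in> curve_components G L"
  shows "open_curve G C \<or> closed_curve G C"
proof -
  have LE: "fst ` L \<subseteq> edges G" and fin: "finite L" and inj: "inj_on fst L"
    and src: "\<And>d d'. d \<in> L \<Longrightarrow> d' \<in> L \<Longrightarrow> dsrc G d = dsrc G d' \<Longrightarrow> d = d'"
    and tgt: "\<And>d d'. d \<in> L \<Longrightarrow> d' \<in> L \<Longrightarrow> dtgt G d = dtgt G d' \<Longrightarrow> d = d'"
    and cons: "\<And>v. v \<in> interior_verts G \<Longrightarrow> v \<in> dsrc G ` L \<longleftrightarrow> v \<in> dtgt G ` L"
    using L by (auto simp: flow_def inj_on_def)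
  obtain d0 where d0: "d0 \<in> L" "C = (adjacency G L)\<^sup>+ `` {d0}"
    using C unfolding curve_components_def by (rule quotientE)
  let ?R = "\<lambda>d d'. dtgt G d = dsrc G d'"
  let ?P = "\<lambda>ds. set ds \<subseteq> L \<and> distinct ds \<and> successively ?R ds \<and> d0 \<in> set ds"
  have "?P [d0]" using d0 by simp
  moreover have "length ds \<le> card L" if "?P ds" for ds
    using that fin by (metis card_mono distinct_card)
  \<comment> \<open>A longest directed path through \<open>d0\<close> exhausts its component.\<close>
  ultimately have "\<exists>ds. ?P ds \<and> (\<forall>ds'. ?P ds' \<longrightarrow> length ds' \<le> length ds)"
    by (intro ex_has_greatest_nat[of ?P "[d0]" length "Suc (card L)"]) (auto simp: less_Suc_eq_le)
  then obtain ds where ds: "?P ds" and max: "\<And>ds'. ?P ds' \<Longrightarrow> length ds' \<le> length ds"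
    by blast
  have ne: "ds \<noteq> []" using ds by auto
  have hdL: "hd ds \<in> L" and lastL: "last ds \<in> L"
    using ds ne by auto
  have out: "d \<in> set ds" if "d \<in> L" "dsrc G d = dtgt G (last ds)" for d
  proof (rule ccontr)
    assume "d \<notin> set ds"
    then have "?P (ds @ [d])"
      using ds that by (auto simp: successively_append_iff)
    with max show False by fastforce
  qed
  have inn: "d \<in> set ds" if "d \<in> L" "dtgt G d = dsrc G (hd ds)" for d
  proof (rule ccontr)
    assume "d \<notin> set ds"
    then have "?P (d # ds)"
      using ds that by (auto simp: successively_Cons)
    with max show False by fastforce
  qed
  \<comment> \<open>The clause \<open>p \<noteq> last ds\<close>, and its mirror image in
    \<open>succ\<close>, is what later contradicts injectivity of \<open>dtgt\<close> and
    \<open>dsrc\<close> on \<open>L\<close>.\<close>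
  have pred: "d = hd ds \<or> (\<exists>p\<in>set ds. p \<noteq> last ds \<and> dtgt G p = dsrc G d)" if d: "d \<in> set ds" for d
  proof -
    obtain i where i: "i < length ds" "d = ds ! i"
      using d by (auto simp: in_set_conv_nth)
    show ?thesis
    proof (cases i)
      case 0
      then show ?thesis using i ne by (simp add: hd_conv_nth)
    next
      case (Suc j)
      then have "ds ! j \<noteq> last ds"
        using i ds ne by (auto simp: last_conv_nth nth_eq_iff_index_eq)
      moreover have "dtgt G (ds ! j) = dsrc G d"
        using ds i Suc by (auto simp: successively_conv_nth)
      ultimately show ?thesis using i Suc by (auto intro!: bexI[of _ "ds ! j"])
    qed
  qed
  have succ: "d = last ds \<or> (\<exists>s\<in>set ds. s \<noteq> hd ds \<and> dsrc G s = dtgt G d)" if d: "d \<in> set ds" for d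
  proof -
    obtain i where i: "i < length ds" "d = ds ! i"
      using d by (auto simp: in_set_conv_nth)
    show ?thesis
    proof (cases "Suc i = length ds")
      case True
      then show ?thesis using i ne by (auto simp: last_conv_nth simp flip: True)
    next
      case False
      then have "ds ! Suc i \<noteq> hd ds"
        using i ds ne by (auto simp: hd_conv_nth nth_eq_iff_index_eq)
      moreover have "dsrc G (ds ! Suc i) = dtgt G d"
        using ds i False by (auto simp: successively_conv_nth)
      ultimately show ?thesis using i False by (auto intro!: bexI[of _ "ds ! Suc i"])
    qed
  qed
  have walk: "walk G ds"
    using ds ne LE inj unfolding walk_def
    by (auto simp: distinct_map intro: inj_on_subset)
  have dist: "distinct (map (dsrc G) ds)"
    using ds src unfolding distinct_map by (intro conjI inj_onI) blast+
  \<comment> \<open>By maximality \<open>d\<close> already lies on the path. Were it not the first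
    edge, its predecessor would have the same target as \<open>last ds\<close> and hence be
    \<open>last ds\<close>.\<close>
  have closed: "dsrc G (hd ds) = dtgt G (last ds)" if d: "d \<in> L" "dsrc G d = dtgt G (last ds)" for d
  proof (cases "d = hd ds")
    case False
    then obtain p where "p \<in> set ds" "p \<noteq> last ds" "dtgt G p = dsrc G d"
      using pred[OF out[OF d]] by blast
    then show ?thesis using tgt[of p "last ds"] ds lastL d by auto
  qed (use d in simp)
  have no_in: "dsrc G (hd ds) = dtgt G (last ds)" if d: "d \<in> L" "dtgt G d = dsrc G (hd ds)" for d
  proof (cases "d = last ds")
    case False
    then obtain s where "s \<in> set ds" "s \<noteq> hd ds" "dsrc G s = dtgt G d"
      using succ[OF inn[OF d]] by blast
    then show ?thesis using src[of s "hd ds"] ds hdL d by auto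
  qed (use d in simp)
  have "open_walk G ds \<or> closed_walk G ds"
  proof (cases "dsrc G (hd ds) = dtgt G (last ds)")
    case True
    then show ?thesis using walk dist by (simp add: closed_walk_def)
  next
    case False
    have verts: "dsrc G d \<in> verts G" "dtgt G d \<in> verts G" if "d \<in> L" for d
    proof -
      obtain e s where d: "d = (e, s)" by (cases d)
      then have "e \<in> edges G" using that LE image_eqI[of e fst d L] by auto
      then show "dsrc G d \<in> verts G" "dtgt G d \<in> verts G"
        using web by (auto simp: d half_plane_graph_def)
    qed
    \<comment> \<open>A path that does not close up has no edge of \<open>L\<close> leaving its end
      or entering its start; conservation then keeps both ends out of the interior.\<close>
    have "dtgt G (last ds) \<notin> dsrc G ` L"
      using False closed by (metis imageE)
    moreover from this have "dtgt G (last ds) \<notin> interior_verts G"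
      using cons lastL by blast
    moreover have "dsrc G (hd ds) \<notin> dtgt G ` L"
      using False no_in by (metis imageE)
    moreover from this have "dsrc G (hd ds) \<notin> interior_verts G"
      using cons hdL by blast
    ultimately show ?thesis
      using walk dist ds verts[OF lastL] verts[OF hdL]
      by (auto simp: open_walk_def boundary_verts_def interior_verts_def)
  qed
  moreover have "set ds = C"
  proof
    show "set ds \<subseteq> C"
    proof
      fix x assume x: "x \<in> set ds"
      have *: "(hd ds, y) \<in> (adjacency G L)\<^sup>+" if "y \<in> set ds" for y
        using ds ne that
        by (intro successively_trancl[where R = ?R]) (auto simp: adjacency_def)
      then have "(d0, x) \<in> (adjacency G L)\<^sup>+"
        using x ds equivE[OF equiv_adjacency[of L G]] by (meson symD transD)
      then show "x \<in> C" using d0(2) by simp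
    qed
  next
    \<comment> \<open>A shared source or a shared target forces equality by injectivity. Otherwise
      \<open>y\<close> follows or precedes \<open>x\<close>, so it is the neighbour of
      \<open>x\<close> on the path or, at an end, is caught by maximality.\<close>
    have closed_under: "y \<in> set ds" if x: "x \<in> set ds" and xy: "(x, y) \<in> adjacency G L" for x y
    proof -
      have L: "x \<in> L" "y \<in> L" using xy by (auto simp: adjacency_def)
      from xy consider "dsrc G x = dsrc G y" | "dtgt G x = dtgt G y"
        | "dtgt G x = dsrc G y" | "dsrc G x = dtgt G y"
        by (auto simp: adjacency_def)
      then show ?thesis
      proof cases
        case 1 then show ?thesis using src L x by blast
      next
        case 2 then show ?thesis using tgt L x by blast
      next
        case 3
        then show ?thesis using succ[OF x] out[of y] src[of _ y] L ds by (metis subsetD)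
      next
        case 4
        then show ?thesis using pred[OF x] inn[of y] tgt[of _ y] L ds by (metis subsetD)
      qed
    qed
    show "C \<subseteq> set ds"
    proof
      fix x assume "x \<in> C"
      then have "(d0, x) \<in> (adjacency G L)\<^sup>+" using d0(2) by simp
      then show "x \<in> set ds"
        by (induction rule: trancl_induct) (use ds closed_under in blast)+
    qed
  qed
  ultimately show ?thesis
    by (auto simp: open_curve_def closed_curve_def)
qed

section \<open>Counting the edges of a flow at a vertex\<close>

lemma dsrc_flow_dedges: "{d \<in> flow_dedges G a. dsrc G d = v} =
    (\<lambda>e. (e, True)) ` {e \<in> out_edges G v. a e = 1} \<union> (\<lambda>e. (e, False)) ` {e \<in> in_edges G v. a e = -1}"
  and dtgt_flow_dedges: "{d \<in> flow_dedges G a. dtgt G d = v} =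
    (\<lambda>e. (e, True)) ` {e \<in> in_edges G v. a e = 1} \<union> (\<lambda>e. (e, False)) ` {e \<in> out_edges G v. a e = -1}"
  by (auto simp: flow_dedges_def in_edges_def out_edges_def)

lemma card_two_images:
  assumes "finite A" "finite B"
  shows "card ((\<lambda>e. (e, True)) ` A \<union> (\<lambda>e. (e, False)) ` B) = card A + card B"
  using assms by (subst card_Un_disjoint) (auto simp: card_image inj_on_def)

lemma net_eq_cards:
  assumes "finite (edges G)" "\<forall>e\<in>edges G. a e \<in> {-1, 0, 1}"
  shows "net G a v = int (card {d \<in> flow_dedges G a. dtgt G d = v}) -
    int (card {d \<in> flow_dedges G a. dsrc G d = v})"
proof -
  have *: "(\<Sum>e\<in>E. a e) = int (card {e \<in> E. a e = 1}) - int (card {e \<in> E. a e = -1})"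
    if "E \<subseteq> edges G" for E
  proof -
    have fin: "finite E" using that assms(1) by (rule finite_subset)
    have "(\<Sum>e\<in>E. a e) = (\<Sum>e\<in>E. of_bool (a e = 1) - of_bool (a e = -1))"
      using that assms(2) by (intro sum.cong) force+
    also have "\<dots> = int (card {e \<in> E. a e = 1}) - int (card {e \<in> E. a e = -1})"
      using fin by (simp add: sum_subtractf Int_def)
    finally show ?thesis .
  qed
  have "net G a v = (\<Sum>e\<in>edges G. if tgt G e = v then a e else 0) -
      (\<Sum>e\<in>edges G. if src G e = v then a e else 0)"
    unfolding net_def sum_subtractf[symmetric] by (intro sum.cong) auto
  also have "\<dots> = (\<Sum>e\<in>in_edges G v. a e) - (\<Sum>e\<in>out_edges G v. a e)"
    using assms(1) by (simp add: sum.inter_filter in_edges_def out_edges_def)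
  also have "\<dots> = int (card {d \<in> flow_dedges G a. dtgt G d = v}) -
      int (card {d \<in> flow_dedges G a. dsrc G d = v})"
    unfolding dsrc_flow_dedges dtgt_flow_dedges using assms(1)
    by (subst (1 2) *) (auto simp: card_two_images in_edges_def out_edges_def)
  finally show ?thesis .
qed

lemma card_filter_le:
  assumes "finite E"
  shows "card {e \<in> E. a e = (1::int)} + card {e \<in> E. a e = -1} \<le> card E"
proof -
  have "card {e \<in> E. a e = 1} + card {e \<in> E. a e = -1} = card ({e \<in> E. a e = 1} \<union> {e \<in> E. a e = -1})"
    using assms by (intro card_Un_disjoint[symmetric]) auto
  also have "\<dots> \<le> card E" using assms by (intro card_mono) auto
  finally show ?thesis .
qed

lemma cards_le_valence:
  assumes "finite (edges G)"
  shows "card {d \<in> flow_dedges G a. dtgt G d = v} + card {d \<in> flow_dedges G a. dsrc G d = v}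
    \<le> valence G v"
proof -
  have fin: "finite (in_edges G v)" "finite (out_edges G v)"
    using assms by (simp_all add: in_edges_def out_edges_def)
  show ?thesis
    using fin card_filter_le[OF fin(1), of a] card_filter_le[OF fin(2), of a]
    unfolding dsrc_flow_dedges dtgt_flow_dedges valence_def
    by (simp add: card_two_images)
qed

text \<open>Here the valences enter. At an interior vertex equally many edges come in and go out,
  and together they are at most 3, so each number is at most 1. At a boundary vertex the total is at
  most 1.\<close>

lemma flow_flow_dedges:
  assumes web: "sl_web n G" and bnd: "\<forall>e\<in>edges G. a e \<in> {-1, 0, 1}"
    and net: "\<forall>v\<in>interior_verts G. net G a v = 0"
  shows "flow G (flow_dedges G a)"
proof -
  let ?L = "flow_dedges G a"
  have fin: "finite (edges G)"
    using web by (simp add: sl_web_def half_plane_graph_def)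
  have LE: "?L \<subseteq> edges G \<times> UNIV" by (auto simp: flow_dedges_def)
  then have finL: "finite ?L" by (rule finite_subset) (use fin in simp)
  have ends: "dsrc G d \<in> verts G" "dtgt G d \<in> verts G" if "d \<in> ?L" for d
    using that web by (cases d; auto simp: flow_dedges_def sl_web_def half_plane_graph_def)+
  have int: "card {d \<in> ?L. dtgt G d = v} = card {d \<in> ?L. dsrc G d = v}" if "v \<in> interior_verts G" for v
    using net_eq_cards[OF fin bnd, of v] net that by simp
  have le1: "card {d \<in> ?L. dtgt G d = v} \<le> 1 \<and> card {d \<in> ?L. dsrc G d = v} \<le> 1" if "v \<in> verts G" for v
  proof (cases "Im v = 0")
    case True
    then have "valence G v = 1"
      using web that by (simp add: sl_web_def boundary_verts_def)
    then show ?thesis using cards_le_valence[OF fin, of a v] by linarith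
  next
    case False
    then have v: "v \<in> interior_verts G" using that by (simp add: interior_verts_def)
    then have "valence G v = 3" using web by (simp add: sl_web_def)
    then show ?thesis using cards_le_valence[OF fin, of a v] int[OF v] by linarith
  qed
  have inj: "inj_on f ?L" if "\<And>d. d \<in> ?L \<Longrightarrow> card {d' \<in> ?L. f d' = f d} \<le> 1" for f :: "_ \<Rightarrow> complex"
  proof (rule inj_onI)
    fix d d' assume d: "d \<in> ?L" "d' \<in> ?L" "f d = f d'"
    have fib: "finite {x \<in> ?L. f x = f d}" using finL by simp
    have all: "\<forall>x\<in>{x \<in> ?L. f x = f d}. \<forall>y\<in>{x \<in> ?L. f x = f d}. x = y"
      using that[OF d(1)] unfolding One_nat_def card_le_Suc0_iff_eq[OF fib] .
    show "d = d'" by (rule all[THEN bspec, THEN bspec]) (simp_all only: mem_Collect_eq d simp_thms)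
  qed
  show ?thesis
    unfolding flow_def
  proof (intro conjI ballI)
    show "fst ` ?L \<subseteq> edges G" using LE by auto
    show "inj_on fst ?L" by (auto simp: inj_on_def flow_dedges_def)
    show "inj_on (dsrc G) ?L" "inj_on (dtgt G) ?L"
      using le1 ends by (auto intro!: inj)
    fix v assume v: "v \<in> interior_verts G"
    have fib: "finite {d \<in> ?L. dtgt G d = v}" "finite {d \<in> ?L. dsrc G d = v}"
      using finL by simp_all
    have "{d \<in> ?L. dtgt G d = v} = {} \<longleftrightarrow> {d \<in> ?L. dsrc G d = v} = {}"
      unfolding card_0_eq[OF fib(1), symmetric] card_0_eq[OF fib(2), symmetric] int[OF v] ..
    moreover have "v \<in> f ` ?L \<longleftrightarrow> {d \<in> ?L. f d = v} \<noteq> {}" for f :: "_ \<Rightarrow> complex"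
      by blast
    ultimately show "v \<in> dsrc G ` ?L \<longleftrightarrow> v \<in> dtgt G ` ?L" by (simp only:)
  qed (rule finL)
qed

text \<open>Different edges meet only in vertices, and an edge passes through a vertex only at its
  ends. A common point is therefore a common end, which puts both directed edges into one
  component.\<close>

lemma trace_components_disjoint:
  assumes L: "flow G L" and web: "half_plane_graph G"
    and C: "C \<in> curve_components G L" and D: "D \<in> curve_components G L" and "C \<noteq> D"
  shows "trace_of G C \<inter> trace_of G D = {}"
proof (rule ccontr)
  assume "trace_of G C \<inter> trace_of G D \<noteq> {}"
  then obtain z d d' where d: "d \<in> C" "d' \<in> D"
    and z: "z \<in> path_image (curve G (fst d))" "z \<in> path_image (curve G (fst d'))"
    by (auto simp: trace_of_def)
  have disj: "C \<inter> D = {}"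
    using quotient_disj[OF equiv_adjacency] C D \<open>C \<noteq> D\<close> unfolding curve_components_def by metis
  have dL: "d \<in> L" "d' \<in> L"
    using d C D Union_curve_components[of G L] by blast+
  then have E: "fst d \<in> edges G" "fst d' \<in> edges G"
    using L by (auto simp: flow_def)
  have "fst d \<noteq> fst d'"
    using L dL d disj by (auto simp: flow_def dest: inj_onD)
  then have "z \<in> verts G"
    using web E z unfolding half_plane_graph_def by blast
  then have "z \<in> {src G (fst d), tgt G (fst d)}" "z \<in> {src G (fst d'), tgt G (fst d')}"
    using web E z unfolding half_plane_graph_def by blast+
  moreover have "{dsrc G x, dtgt G x} = {src G (fst x), tgt G (fst x)}" for x
    by (cases x) auto
  ultimately have "{dsrc G d, dtgt G d} \<inter> {dsrc G d', dtgt G d'} \<noteq> {}"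
    by (metis IntI empty_iff)
  then have "d' \<in> C"
    using curve_component_closed[OF C d(1) dL(2)] by simp
  then show False using d disj by blast
qed

section \<open>Strandings from labellings\<close>

lemma constant_between:
  fixes b :: "nat \<Rightarrow> 'a"
  assumes "p \<le> q" "\<And>c. p \<le> c \<Longrightarrow> c < q \<Longrightarrow> b c = b (Suc c)"
  shows "b p = b q"
  using assms by (induction q rule: dec_induct) auto

text \<open>The converse of \<open>labelling_strand_bit\<close>: the strands of colour
  \<open>c\<close> are the components of the flow of differences between bits \<open>c\<close> and
  \<open>c + 1\<close>. Signs alternate because successive jumps of a 0-1 sequence do.\<close>

lemma stranding_of_labelling:
  assumes web: "sl_web n G" and b: "labelling n G b" and n: "n \<ge> 1"
  obtains S where "S \<in> strandings n G"
    and "\<And>e i. e \<in> edges G \<Longrightarrow> i \<in> {1..n} \<Longrightarrow> strand_bit n S e i = b e i"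
proof -
  define L where "L c = flow_dedges G (\<lambda>e. b e c - b e (Suc c))" for c
  define S where "S = {(c, C). c \<in> {1..n-1} \<and> C \<in> curve_components G (L c)}"
  have hp: "half_plane_graph G" using web by (simp add: sl_web_def)
  have bin: "b e i = 0 \<or> b e i = 1" if "e \<in> edges G" "1 \<le> i" "i \<le> n" for e i
    using b that by (auto simp: labelling_def)
  have flow: "flow G (L c)" if c: "c \<in> {1..n-1}" for c
    unfolding L_def
  proof (rule flow_flow_dedges[OF web])
    have c': "c \<in> {1..n}" "Suc c \<in> {1..n}" using c by auto
    show "\<forall>e\<in>edges G. b e c - b e (Suc c) \<in> {- 1, 0, 1}"
      using bin[of _ c] bin[of _ "Suc c"] c' by fastforce
    have "net G (\<lambda>e. b e c - b e (Suc c)) v = net G (\<lambda>e. b e c) v - net G (\<lambda>e. b e (Suc c)) v" for v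
      by (simp add: net_def left_diff_distrib sum_subtractf)
    then show "\<forall>v\<in>interior_verts G. net G (\<lambda>e. b e c - b e (Suc c)) v = 0"
      using b c' by (simp add: labelling_def)
  qed
  have st: "is_stranding n G S"
    using flow curve_component_curve[OF _ hp] trace_components_disjoint[OF _ hp]
    unfolding is_stranding_def S_def by blast
  have comp: "(\<exists>C. (c, C) \<in> S \<and> d \<in> C) \<longleftrightarrow> c \<in> {1..n-1} \<and> d \<in> L c" for c d
    using Union_curve_components[of G "L c"] unfolding S_def by blast
  have pos: "colors_pos S e = {c \<in> {1..n-1}. b e c - b e (Suc c) = 1}"
    and neg: "colors_neg S e = {c \<in> {1..n-1}. b e c - b e (Suc c) = -1}" if "e \<in> edges G" for e
    using that unfolding colors_pos_def colors_neg_def comp by (auto simp: L_def flow_dedges_def)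
  have coroot: "coroot S e c = b e c - b e (Suc c)" if "e \<in> edges G" "c \<in> {1..n-1}" for e c
  proof -
    have "c \<le> n" "Suc c \<le> n" using that(2) n by auto
    then show ?thesis
      using that bin[of e c] bin[of e "Suc c"] by (auto simp: coroot_def pos neg)
  qed
  have cols: "colors S e = {c \<in> {1..n-1}. b e c \<noteq> b e (Suc c)}" if "e \<in> edges G" for e
  proof -
    have "b e c - b e (Suc c) = 1 \<or> b e c - b e (Suc c) = -1 \<longleftrightarrow> b e c \<noteq> b e (Suc c)"
      if "c \<in> {1..n-1}" for c
    proof -
      have "c \<le> n" "Suc c \<le> n" using that n by auto
      then show ?thesis
        using that bin[OF \<open>e \<in> edges G\<close>, of c] bin[OF \<open>e \<in> edges G\<close>, of "Suc c"] by auto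
    qed
    then show ?thesis using that by (auto simp: colors_def pos neg)
  qed
  have between: "b e p = b e q"
    if "e \<in> edges G" "1 \<le> p" "p \<le> q" "q \<le> n" "colors S e \<inter> {p..<q} = {}" for e p q
  proof (rule constant_between[OF that(3)])
    fix c assume c: "p \<le> c" "c < q"
    then have "c \<notin> colors S e" "c \<in> {1..n-1}" using that by auto
    then show "b e c = b e (Suc c)" using that(1) by (auto simp: cols)
  qed
  have fin: "finite (colors S e)" for e
    using colors_stranding[OF st] by (rule finite_subset) simp
  have nonempty: "colors S e \<noteq> {}" if e: "e \<in> edges G" for e
  proof
    assume empty: "colors S e = {}"
    \<comment> \<open>Without colours the vector is constant and has 0 or \<open>n\<close> ones,
      which the range of the weights excludes.\<close>
    have "(\<Sum>i=1..n. b e i) = (\<Sum>i=1..n. b e n)"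
      using empty e by (intro sum.cong refl between) auto
    then have "int n * b e n = int (weight G e)"
      using b e by (simp add: labelling_def)
    moreover have "weight G e \<in> {1..n-1}"
      using web e by (simp add: sl_web_def)
    ultimately show False
      using bin[of e n] e n by auto
  qed
  have top: "b e n = (if Max (colors S e) \<in> colors_pos S e then 0 else 1)" if e: "e \<in> edges G" for e
  proof -
    let ?m = "Max (colors S e)"
    have m: "?m \<in> colors S e" using fin nonempty[OF e] by (rule Max_in)
    then have m': "1 \<le> ?m" "Suc ?m \<le> n" "b e ?m \<noteq> b e (Suc ?m)" using cols[OF e] by auto
    have "x \<notin> colors S e" if "Suc ?m \<le> x" for x
      using Max_ge[OF fin[of e], of x] that by linarith
    \<comment> \<open>The last jump is at \<open>?m\<close>, so the top bit is the value after it: 0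
      after a descent, 1 after an ascent.\<close>
    then have "b e (Suc ?m) = b e n"
      using m' e by (intro between) auto
    then show ?thesis
      using m' bin[of e ?m] bin[of e n] e n by (auto simp: pos)
  qed
  have bits: "strand_bit n S e i = b e i" if e: "e \<in> edges G" and i: "i \<in> {1..n}" for e i
  proof -
    have "i \<le> n" using i by simp
    then show ?thesis
      using i
    proof (induction i rule: inc_induct)
      case base
      then show ?case using top[OF e] by (simp add: strand_bit_top)
    next
      case (step i)
      then show ?case
        using strand_bit_step[OF step.hyps(2), of S e] coroot[OF e, of i] by auto
    qed
  qed
  have valid: "valid_on n G S e" if e: "e \<in> edges G" for e
    unfolding valid_on_def
  proof (intro conjI ballI impI)
    fix c d assume c: "c \<in> colors S e" and d: "d \<in> colors S e"
      and cd: "c < d \<and> colors S e \<inter> {c<..<d} = {}"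
    have c': "c \<in> {1..n-1}" "b e c \<noteq> b e (Suc c)" and d': "d \<in> {1..n-1}" "b e d \<noteq> b e (Suc d)"
      using c d cols[OF e] by auto
    then have "c \<le> n" "d \<le> n" "Suc d \<le> n" using n by auto
    \<comment> \<open>The value reached by the jump at \<open>c\<close> is the one left by the jump
      at \<open>d\<close>.\<close>
    have "b e (Suc c) = b e d"
      using cd d' e by (intro between) (auto simp: atLeastSucLessThan_greaterThanLessThan)
    with \<open>c \<le> n\<close> \<open>d \<le> n\<close> \<open>Suc d \<le> n\<close> show "coroot S e d = - coroot S e c"
      using c' d' coroot[OF e] bin[of e c] bin[of e d] bin[of e "Suc d"] e by auto
  next
    have "(\<Sum>c\<in>{1..n-1}. coroot S e c * int c) = (\<Sum>c\<in>{1..n-1}. (b e c - b e (Suc c)) * int c)"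
      using coroot[OF e] by simp
    also have "\<dots> = int (weight G e) - int n * b e n"
      using weighted_telescope[OF n, of "b e"] b e by (simp add: labelling_def)
    finally show "(\<Sum>c\<in>{1..n-1}. coroot S e c * int c) =
        (if Max (colors S e) \<in> colors_pos S e then int (weight G e) else int (weight G e) - int n)"
      using top[OF e] by (simp split: if_splits)
  qed (rule nonempty[OF e])
  show ?thesis
    using st valid bits by (intro that[of S]) (auto simp: strandings_def)
qed

section \<open>Reversing a strand\<close>

definition swap_on :: "'e dedge set \<Rightarrow> nat \<Rightarrow> nat \<Rightarrow> ('e \<Rightarrow> nat \<Rightarrow> int) \<Rightarrow> 'e \<Rightarrow> nat \<Rightarrow> int" where
  "swap_on C i j b e k = (if e \<in> fst ` C then b e (Transposition.transpose i j k) else b e k)"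

text \<open>At a vertex of \<open>C\<close>, every incident edge outside \<open>C\<close> has equal
  bits at \<open>i\<close> and \<open>j\<close>, since otherwise it would belong to the component.
  The swap thus acts there as one transposition on all incident edges, and conservation is symmetric
  in the positions. At other vertices nothing changes.\<close>

lemma labelling_swap_on:
  assumes b: "labelling n G b" and ij: "i \<in> {1..n}" "j \<in> {1..n}"
    and C: "C \<in> curve_components G (flow_dedges G (\<lambda>e. b e i - b e j))"
  shows "labelling n G (swap_on C i j b)"
  unfolding labelling_def
proof (intro conjI ballI)
  have tr: "Transposition.transpose i j k \<in> {1..n}" if "k \<in> {1..n}" for k
    using ij that by (auto simp: Transposition.transpose_def)
  {
    fix e assume e: "e \<in> edges G"
    show "swap_on C i j b e k \<in> {0, 1}" if "k \<in> {1..n}" for k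
      using b e that tr[OF that] by (simp add: labelling_def swap_on_def)
    have "(\<Sum>k=1..n. b e (Transposition.transpose i j k)) = (\<Sum>k=1..n. b e k)"
      using sum.permute[OF permutes_swap_id[OF ij], of "b e"] by (simp add: o_def)
    then show "(\<Sum>k=1..n. swap_on C i j b e k) = int (weight G e)"
      using b e by (cases "e \<in> fst ` C") (simp_all add: labelling_def swap_on_def)
  }
  have net: "net G (\<lambda>e. b e k) v = net G (\<lambda>e. b e l) v"
    if "v \<in> interior_verts G" "k \<in> {1..n}" "l \<in> {1..n}" for v k l
    using b that unfolding labelling_def by blast
  fix v k l assume v: "v \<in> interior_verts G" and k: "k \<in> {1..n}" and l: "l \<in> {1..n}"
  show "net G (\<lambda>e. swap_on C i j b e k) v = net G (\<lambda>e. swap_on C i j b e l) v"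
  proof (cases "\<exists>d\<in>C. v \<in> {dsrc G d, dtgt G d}")
    case True
    then obtain d where d: "d \<in> C" "v \<in> {dsrc G d, dtgt G d}" by blast
    have "swap_on C i j b e k = b e (Transposition.transpose i j k)"
      if e: "e \<in> edges G" and ev: "tgt G e = v \<or> src G e = v" for e k
    proof (cases "e \<in> fst ` C")
      case False
      have not_flow: "(e, s) \<notin> flow_dedges G (\<lambda>e. b e i - b e j)" for s
      proof
        assume "(e, s) \<in> flow_dedges G (\<lambda>e. b e i - b e j)"
        moreover have "{dsrc G d, dtgt G d} \<inter> {dsrc G (e, s), dtgt G (e, s)} \<noteq> {}"
          using d(2) ev by (cases s) auto
        ultimately have "(e, s) \<in> C"
          using curve_component_closed[OF C d(1)] by blast
        with False show False using image_eqI[of e fst "(e, s)" C] by simp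
      qed
      have "b e i \<in> {0, 1}" "b e j \<in> {0, 1}"
        using b e ij by (simp_all add: labelling_def)
      then have "b e i = b e j"
        using not_flow[of True] not_flow[of False] e by (auto simp: flow_dedges_def)
      then show ?thesis using False by (simp add: swap_on_def Transposition.transpose_def)
    qed (simp add: swap_on_def)
    then have "net G (\<lambda>e. swap_on C i j b e k) v = net G (\<lambda>e. b e (Transposition.transpose i j k)) v" for k
      by (intro net_cong)
    then show ?thesis using net[OF v tr[OF k] tr[OF l]] by (simp only:)
  next
    case False
    have "swap_on C i j b e k = b e k" if "tgt G e = v \<or> src G e = v" for e k
    proof -
      have "v \<in> {dsrc G (e, s), dtgt G (e, s)}" for s
        using that by auto
      then have "(e, s) \<notin> C" for s
        using False by blast
      then show ?thesis by (auto simp: swap_on_def)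
    qed
    then have "net G (\<lambda>e. swap_on C i j b e k) v = net G (\<lambda>e. b e k) v" for k
      by (intro net_cong)
    then show ?thesis using net[OF v k l] by (simp only:)
  qed
qed

lemma strands_eq:
  "strands n G S i j = curve_components G (flow_dedges G (\<lambda>e. strand_bit n S e i - strand_bit n S e j))"
  by (simp add: strands_def strand_dedges_def flow_dedges_def)

section \<open>Boundary vertices and the order of monomials\<close>

lemma boundary_edge_unique:
  assumes web: "sl_web n G" and v: "v \<in> boundary_verts G"
  shows "boundary_edge G v \<in> edges G"
    and "tgt G (boundary_edge G v) = v \<longleftrightarrow> src G (boundary_edge G v) \<noteq> v"
    and "f \<in> edges G \<Longrightarrow> tgt G f = v \<or> src G f = v \<Longrightarrow> f = boundary_edge G v"
proof -
  have fin: "finite (in_edges G v)" "finite (out_edges G v)"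
    using web by (simp_all add: sl_web_def half_plane_graph_def in_edges_def out_edges_def)
  have "card (in_edges G v) + card (out_edges G v) = 1"
    using web v by (simp add: sl_web_def valence_def)
  then obtain e where e: "in_edges G v = {e} \<and> out_edges G v = {} \<or> in_edges G v = {} \<and> out_edges G v = {e}"
    using fin by (auto simp: add_is_1 card_1_singleton_iff)
  then have be: "boundary_edge G v = e"
    unfolding boundary_edge_def by (intro the_equality) auto
  have "e \<in> edges G \<and> (tgt G e = v \<longleftrightarrow> src G e \<noteq> v) \<and>
      (\<forall>f. f \<in> edges G \<longrightarrow> tgt G f = v \<or> src G f = v \<longrightarrow> f = e)"
    using e unfolding in_edges_def out_edges_def by blast
  then show "boundary_edge G v \<in> edges G"
    and "tgt G (boundary_edge G v) = v \<longleftrightarrow> src G (boundary_edge G v) \<noteq> v"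
    and "f \<in> edges G \<Longrightarrow> tgt G f = v \<or> src G f = v \<Longrightarrow> f = boundary_edge G v"
    unfolding be by blast+
qed

text \<open>Only one edge touches \<open>v\<close>, and with exactly one end, so a walk using it has
  flux 1 or -1 at \<open>v\<close>; by \<open>walk_flux\<close> this is impossible unless the walk
  starts or ends there.\<close>

lemma open_walk_boundary_verts:
  assumes web: "sl_web n G" and ds: "open_walk G ds" and v: "v \<in> boundary_verts G"
    and "boundary_edge G v \<in> fst ` set ds"
  shows "v = dsrc G (hd ds) \<or> v = dtgt G (last ds)"
proof (rule ccontr)
  assume neg: "\<not> (v = dsrc G (hd ds) \<or> v = dtgt G (last ds))"
  let ?g = "\<lambda>d. of_bool (dtgt G d = v) - of_bool (dsrc G d = v) :: int"
  have walk: "walk G ds" using ds by (simp add: open_walk_def)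
  obtain s where d: "(boundary_edge G v, s) \<in> set ds" using assms(4) by force
  have "?g d = 0" if "d \<in> set ds" "d \<noteq> (boundary_edge G v, s)" for d
  proof -
    have "inj_on fst (set ds)" "fst d \<in> edges G"
      using walk that by (auto simp: walk_def distinct_map)
    then have "fst d \<noteq> boundary_edge G v"
      using that d inj_onD[of fst "set ds" d "(boundary_edge G v, s)"] by auto
    then have "tgt G (fst d) \<noteq> v \<and> src G (fst d) \<noteq> v"
      using boundary_edge_unique(3)[OF web v \<open>fst d \<in> edges G\<close>] by blast
    then show ?thesis by (cases d) auto
  qed
  then have "(\<Sum>d\<in>set ds. ?g d) = (\<Sum>d\<in>{(boundary_edge G v, s)}. ?g d)"
    using d by (intro sum.mono_neutral_right) auto
  moreover have "(\<Sum>d\<in>set ds. ?g d) = (\<Sum>d\<leftarrow>ds. ?g d)"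
    using walk by (intro sum_list_distinct_conv_sum_set[symmetric]) (simp add: walk_def distinct_map)
  moreover have "\<dots> = of_bool (dtgt G (last ds) = v) - of_bool (dsrc G (hd ds) = v)"
    using walk by (intro walk_flux) (auto simp: walk_def)
  moreover have "\<dots> = (0 :: int)"
    using neg by auto
  ultimately have "(\<Sum>d\<in>{(boundary_edge G v, s)}. ?g d) = 0"
    by (simp only:)
  then show False
    using boundary_edge_unique(2)[OF web v] by (auto split: if_splits)
qed

lemma set_boundary_list:
  assumes "finite (verts G)"
  shows "set (boundary_list G) = boundary_verts G"
proof -
  have "complex_of_real (Re v) = v" if "v \<in> boundary_verts G" for v
    using that by (simp add: boundary_verts_def complex_eq_iff)
  then have "(\<lambda>v. complex_of_real (Re v)) ` boundary_verts G = boundary_verts G"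
    by simp
  then show ?thesis
    using assms by (simp add: boundary_list_def boundary_verts_def image_image)
qed

lemma sorted_boundary_list: "sorted_wrt (\<lambda>v w. Re v < Re w) (boundary_list G)"
  by (simp add: boundary_list_def sorted_wrt_map)

text \<open>Bit \<open>b\<^sub>k\<close> sits at list index \<open>k - 1\<close>.\<close>

lemma ones_seq_less:
  assumes len: "length x = n" "length y = n" and ij: "1 \<le> i" "i < j" "j \<le> n"
    and eq: "\<And>k. k < i - 1 \<Longrightarrow> x ! k = y ! k"
    and "x ! (i - 1) = 1" "y ! (i - 1) \<noteq> 1" "y ! (j - 1) = 1"
  shows "\<exists>p a b s t. ones_seq x = p @ a # s \<and> ones_seq y = p @ b # t \<and> a < b"
proof -
  have split: "[1..<Suc n] = [1..<i] @ i # [Suc i..<Suc n]"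
    using ij upt_add_eq_append[of 1 i "Suc n - i"] upt_conv_Cons[of i "Suc n"] by (simp del: upt_Suc)
  let ?fx = "filter (\<lambda>k. x ! (k - 1) = 1)" and ?fy = "filter (\<lambda>k. y ! (k - 1) = 1)"
  have x: "ones_seq x = ?fx [1..<i] @ i # ?fx [Suc i..<Suc n]"
    using assms unfolding ones_seq_def len split by simp
  have "?fx [1..<i] = ?fy [1..<i]"
    using eq ij by (intro filter_cong refl) (auto intro!: arg_cong[where f = "\<lambda>z. z = 1"])
  then have y: "ones_seq y = ?fx [1..<i] @ ?fy [Suc i..<Suc n]"
    using assms unfolding ones_seq_def len split by simp
  \<comment> \<open>The one at \<open>j\<close> keeps \<open>ones_seq y\<close> from stopping here.
    Otherwise, after concatenation, \<open>i\<close> would be compared with an entry of the next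
    block.\<close>
  have "j \<in> set (?fy [Suc i..<Suc n])"
    using assms by (auto simp del: upt_Suc)
  then obtain b t where bt: "?fy [Suc i..<Suc n] = b # t"
    by (metis empty_iff empty_set neq_Nil_conv)
  then have "b \<in> set (?fy [Suc i..<Suc n])" by (simp only: list.set_intros)
  then have "i < b" by (simp del: upt_Suc)
  then show ?thesis using x y bt by metis
qed

lemma monomial_less_asym: "monomial_less x y \<Longrightarrow> \<not> monomial_less y x"
  unfolding monomial_less_def by (rule lexord_asymmetric) (auto simp: asym_on_def intro!: asymI)

section \<open>Leading terms\<close>

lemma swap_monomial_less:
  assumes web: "sl_web n G" and S: "S \<in> strandings n G" and n: "1 \<le> n"
    and ij: "1 \<le> i" "i < j" "j \<le> n"
    and ds: "open_walk G ds" "set ds \<subseteq> strand_dedges n G S i j"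
    and ccw: "Re (dsrc G (hd ds)) < Re (dtgt G (last ds))"
    and T: "\<And>e k. e \<in> edges G \<Longrightarrow> k \<in> {1..n} \<Longrightarrow>
      strand_bit n T e k = swap_on (set ds) i j (strand_bit n S) e k"
  shows "monomial_less (stranding_monomial n G T) (stranding_monomial n G S)"
proof -
  define u where "u = dsrc G (hd ds)"
  have hp: "half_plane_graph G" using web by (simp add: sl_web_def)
  then have fin: "finite (verts G)" "finite (edges G)" by (simp_all add: half_plane_graph_def)
  have hd: "hd ds \<in> set ds" using ds(1) by (simp add: open_walk_def walk_def)
  have u: "u \<in> boundary_verts G" using ds(1) by (simp add: u_def open_walk_def)
  then obtain xs ys where xy: "boundary_list G = xs @ u # ys"
    using set_boundary_list[OF fin(1)] by (metis split_list)
  obtain e s where es: "hd ds = (e, s)" by (cases "hd ds")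
  have L: "(e, s) \<in> strand_dedges n G S i j" and e_in: "e \<in> fst ` set ds"
    using hd ds(2) es by (auto intro: image_eqI[of _ fst "(e, s)"])
  have eE: "e \<in> edges G" using L by (auto simp: strand_dedges_def)
  have eu: "tgt G e = u \<or> src G e = u" using es by (auto simp: u_def)
  have be: "boundary_edge G u = e"
    using boundary_edge_unique(3)[OF web u eE eu] by simp
  have bin: "strand_bit n S e k \<in> {0, 1}" if "k \<in> {1..n}" for k
    using labelling_strand_bit[OF S fin(2) n] eE that by (simp add: labelling_def)
  have T_e: "strand_bit n T e k = strand_bit n S e (Transposition.transpose i j k)" if "k \<in> {1..n}" for k
    using T[OF eE that] e_in by (simp add: swap_on_def)
  have same: "boundary_bits n G T v = boundary_bits n G S v" if "v \<in> set xs" for v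
  proof -
    have v: "v \<in> boundary_verts G"
      using that set_boundary_list[OF fin(1)] by (auto simp: xy)
    have "Re v < Re u"
      using sorted_boundary_list[of G] that by (auto simp: xy sorted_wrt_append)
    \<comment> \<open>The walk meets boundary edges only at its two ends, and neither is left of
      \<open>u\<close>.\<close>
    then have "boundary_edge G v \<notin> fst ` set ds"
      using open_walk_boundary_verts[OF web ds(1) v] ccw by (metis less_asym less_irrefl u_def)
    then have "strand_bit n T (boundary_edge G v) k = strand_bit n S (boundary_edge G v) k"
      if "k \<in> {1..n}" for k
      using T[OF boundary_edge_unique(1)[OF web v] that] by (simp add: swap_on_def)
    then show ?thesis
      unfolding boundary_bits_def Let_def by (intro map_cong refl) auto
  qed
  have nth: "boundary_bits n G R u ! (k - 1) =
      (if tgt G e = u then strand_bit n R e k else 1 - strand_bit n R e k)"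
    if "k \<in> {1..n}" for R k
  proof -
    have "k - 1 < length [1..<Suc n]" "[1..<Suc n] ! (k - 1) = k"
      using that by (auto simp: nth_upt simp del: upt_Suc)
    then show ?thesis
      by (simp only: boundary_bits_def be Let_def nth_map)
  qed
  \<comment> \<open>Both directions of \<open>e\<close> agree. If \<open>e\<close> points out of
    \<open>u\<close>, the strand follows it, the bits at \<open>i\<close>, \<open>j\<close> are 1,
    0, and the boundary vector complements them; if \<open>e\<close> points into \<open>u\<close>,
    the strand runs against it and the bits are 0, 1 already.\<close>
  have start: "(if tgt G e = u then strand_bit n S e i else 1 - strand_bit n S e i) = 0 \<and>
      (if tgt G e = u then strand_bit n S e j else 1 - strand_bit n S e j) = 1"
  proof -
    have "i \<in> {1..n}" "j \<in> {1..n}" using ij by auto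
    moreover have "tgt G e = u \<longleftrightarrow> src G e \<noteq> u"
      using boundary_edge_unique(2)[OF web u] by (simp only: be)
    moreover have "u = (if s then src G e else tgt G e)"
      by (simp add: u_def es)
    ultimately show ?thesis
      using L bin[of i] bin[of j] by (cases s) (auto simp: strand_dedges_def)
  qed
  have "\<exists>p a b s t. ones_seq (boundary_bits n G T u) = p @ a # s \<and>
      ones_seq (boundary_bits n G S u) = p @ b # t \<and> a < b"
  proof (rule ones_seq_less[where n = n])
    show "boundary_bits n G T u ! k = boundary_bits n G S u ! k" if "k < i - 1" for k
    proof -
      have "Suc k \<in> {1..n}" "Suc k \<noteq> i" "Suc k \<noteq> j" using that ij by auto
      then show ?thesis using nth[of "Suc k"] T_e[of "Suc k"] by simp
    qed
    show "boundary_bits n G T u ! (i - 1) = 1" "boundary_bits n G S u ! (i - 1) \<noteq> 1"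
      "boundary_bits n G S u ! (j - 1) = 1"
      using nth[of i] nth[of j] T_e[of i] start ij by (auto simp del: One_nat_def)
  qed (use ij in \<open>simp_all add: boundary_bits_def Let_def\<close>)
  then obtain p a b s t where pab: "ones_seq (boundary_bits n G T u) = p @ a # s"
    "ones_seq (boundary_bits n G S u) = p @ b # t" "a < b" by blast
  have "map (ones_seq \<circ> boundary_bits n G T) xs = map (ones_seq \<circ> boundary_bits n G S) xs"
    using same by simp
  then show ?thesis
    using pab unfolding monomial_less_def stranding_monomial_def xy
    by (simp add: lexord_same_pref_iff del: map_eq_conv)
qed

theorem lemma30:
  fixes n :: nat and k :: "nat list" and G :: "'e web" and S :: "'e stranding"
  assumes "n \<ge> 2"
    and "\<forall>l\<in>set k. 1 \<le> l \<and> l \<le> n - 1"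
    and "G \<in> webs n k"
    and "leading_term_stranding n G S"
  shows "\<forall>i j. 1 \<le> i \<and> i < j \<and> j \<le> n \<longrightarrow>
           (\<forall>C\<in>strands n G S i j. open_curve G C \<longrightarrow> clockwise_open G C)"
proof (intro allI impI ballI)
  fix i j C assume ij: "1 \<le> i \<and> i < j \<and> j \<le> n" and C: "C \<in> strands n G S i j"
    and "open_curve G C"
  then obtain ds where ds: "open_walk G ds" "set ds = C" by (auto simp: open_curve_def)
  have web: "sl_web n G" using assms(3) by (simp add: webs_def)
  then have fin: "finite (edges G)" by (simp add: sl_web_def half_plane_graph_def)
  have S: "S \<in> strandings n G" and lt: "leading_term (web_vector n G) (stranding_monomial n G S)"
    using assms(4) by (simp_all add: leading_term_stranding_def)
  have n: "1 \<le> n" using assms(1) by simp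
  show "clockwise_open G C"
  proof (rule ccontr)
    assume "\<not> clockwise_open G C"
    then have "\<not> Re (dtgt G (last ds)) < Re (dsrc G (hd ds))"
      using ds by (auto simp: clockwise_open_def)
    moreover have "dtgt G (last ds) \<noteq> dsrc G (hd ds)"
      using ds(1) by (cases ds) (auto simp: open_walk_def walk_def)
    \<comment> \<open>The ends are distinct points of the real axis, so their real parts
      differ.\<close>
    ultimately have ccw: "Re (dsrc G (hd ds)) < Re (dtgt G (last ds))"
      using ds(1) by (auto simp: open_walk_def boundary_verts_def complex_eq_iff)
    have "labelling n G (swap_on C i j (strand_bit n S))"
      using labelling_strand_bit[OF S fin n] C ij
      by (intro labelling_swap_on) (auto simp: strands_eq)
    then obtain T where T: "T \<in> strandings n G"
      and bits: "\<And>e k. e \<in> edges G \<Longrightarrow> k \<in> {1..n} \<Longrightarrow>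
        strand_bit n T e k = swap_on C i j (strand_bit n S) e k"
      using stranding_of_labelling[OF web _ n] by blast
    have "C \<subseteq> strand_dedges n G S i j"
      using C Union_curve_components[of G "strand_dedges n G S i j"] by (auto simp: strands_def)
    then have less: "monomial_less (stranding_monomial n G T) (stranding_monomial n G S)"
      using ij ds ccw bits by (intro swap_monomial_less[OF web S n, of i j ds]) auto
    \<comment> \<open>The monomial of \<open>T\<close> has nonzero coefficient and, by asymmetry of
      the order, differs from that of \<open>S\<close>; so minimality of the leading term applies to
      it.\<close>
    then have "monomial_less (stranding_monomial n G S) (stranding_monomial n G T)"
      using lt keys_web_vector[OF fin T] monomial_less_asym unfolding leading_term_def by metis
    with less show False using monomial_less_asym by blast
  qed
qed

end
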